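(* Let $\mathcal{A}$ be the affine space of real $4\times4$ matrices with all row and column sums equal to $1$, with direction space $W$ (matrices with zero row and column sums) and distance $D(A,B)=\sqrt{\mathrm{Tr}\,(A-B)(A-B)^T}$, and let $B_\star$ be the matrix with all entries $1/4$. Then: (i) every neighbourhood of $B_\star$ in $\mathcal{A}$ contains $4\times 4$ bistochastic matrices that are not unistochastic; (ii) let $f:U(4)\to\mathcal{A}$, $f(U)_{ij}=|U_{ij}|^2$; for every unitary $U_0$ with $f(U_0)=B_\star$, the image of the differential $df_{U_0}$ of $f$ at $U_0$ is contained in the direction space of one of the nine hyperplanes $\Pi_{r,c}=\{B\in\mathcal{A}: B_{00}+B_{0c}+B_{r0}+B_{rc}=1\}$, $r,c\in\{1,2,3\}$ (rows and columns indexed $0,1,2,3$).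
   Context: A real $N\times N$ matrix $B$ is bistochastic if $B_{ij}\ge0$ and all row and column sums equal $1$; it is unistochastic if there is a unitary $U$ with $B_{ij}=|U_{ij}|^2$ for all $i,j$. *)

theory Defs
  imports "HOL-Analysis.Analysis"
begin

definition bistochastic :: "real^'n^'n \<Rightarrow> bool" where
  "bistochastic B \<longleftrightarrow>
     (\<forall>i j. 0 \<le> B $ i $ j) \<and> (\<forall>i. (\<Sum>j\<in>UNIV. B $ i $ j) = 1) \<and> (\<forall>j. (\<Sum>i\<in>UNIV. B $ i $ j) = 1)"

definition conj_transpose :: "complex^'n^'m \<Rightarrow> complex^'m^'n" where
  "conj_transpose U = (\<chi> i j. cnj (U $ j $ i))"

definition unitary_group :: "(complex^'n^'n) set" where
  "unitary_group = {U. conj_transpose U ** U = mat 1 \<and> U ** conj_transpose U = mat 1}"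

definition unistochastic :: "real^'n^'n \<Rightarrow> bool" where
  "unistochastic B \<longleftrightarrow> (\<exists>U\<in>unitary_group. \<forall>i j. B $ i $ j = (cmod (U $ i $ j))\<^sup>2)"

definition sums_one :: "(real^'n^'n) set" where
  "sums_one = {B. (\<forall>i. (\<Sum>j\<in>UNIV. B $ i $ j) = 1) \<and> (\<forall>j. (\<Sum>i\<in>UNIV. B $ i $ j) = 1)}"

definition sums_zero :: "(real^'n^'n) set" where
  "sums_zero = {B. (\<forall>i. (\<Sum>j\<in>UNIV. B $ i $ j) = 0) \<and> (\<forall>j. (\<Sum>i\<in>UNIV. B $ i $ j) = 0)}"

definition direction :: "'a::real_vector set \<Rightarrow> 'a set" where
  "direction S = {x - y | x y. x \<in> S \<and> y \<in> S}"

lemma direction_sums_one: "direction (sums_one :: (real^'n^'n) set) = sums_zero"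
proof
  show "direction (sums_one :: (real^'n^'n) set) \<subseteq> sums_zero"
    by (auto simp: direction_def sums_one_def sums_zero_def sum_subtractf)
next
  show "sums_zero \<subseteq> direction (sums_one :: (real^'n^'n) set)"
  proof
    fix X :: "real^'n^'n" assume X: "X \<in> sums_zero"
    have "mat 1 \<in> (sums_one :: (real^'n^'n) set)"
      by (simp add: sums_one_def mat_def)
    moreover have "X + mat 1 \<in> sums_one"
      using X by (simp add: sums_one_def sums_zero_def mat_def sum.distrib)
    moreover have "X = (X + mat 1) - mat 1" by simp
    ultimately show "X \<in> direction sums_one"
      unfolding direction_def by blast
  qed
qed

definition mat_dist :: "real^'n^'n \<Rightarrow> real^'n^'n \<Rightarrow> real" where
  "mat_dist A B = sqrt (trace ((A - B) ** transpose (A - B)))"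

lemma mat_dist_eq_dist: "mat_dist A B = dist A B"
  by (simp add: mat_dist_def trace_def matrix_matrix_mult_def transpose_def dist_norm
      norm_eq_sqrt_inner inner_vec_def)

definition nbhd_in_sums_one :: "(real^'n^'n) set \<Rightarrow> real^'n^'n \<Rightarrow> bool" where
  "nbhd_in_sums_one N A \<longleftrightarrow>
     N \<subseteq> sums_one \<and> A \<in> sums_one \<and> (\<exists>e>0. {B \<in> sums_one. mat_dist A B < e} \<subseteq> N)"

text \<open>The differential of a map on a submanifold of a normed space, by velocities of
  curves. The map is only evaluated on the submanifold near the base point.\<close>

definition curve_with_velocity ::
  "'a::real_normed_vector set \<Rightarrow> 'a \<Rightarrow> 'a \<Rightarrow> (real \<Rightarrow> 'a) \<Rightarrow> bool" where
  "curve_with_velocity M p v \<gamma> \<longleftrightarrow>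
     (\<exists>e>0. \<gamma> C1_differentiable_on {-e<..<e} \<and> \<gamma> ` {-e<..<e} \<subseteq> M) \<and>
     \<gamma> 0 = p \<and> (\<gamma> has_vector_derivative v) (at 0)"

definition tangent_space :: "'a::real_normed_vector set \<Rightarrow> 'a \<Rightarrow> 'a set" where
  "tangent_space M p = {v. \<exists>\<gamma>. curve_with_velocity M p v \<gamma>}"

definition differential ::
  "'a::real_normed_vector set \<Rightarrow> ('a \<Rightarrow> 'b::real_normed_vector) \<Rightarrow> 'a \<Rightarrow> 'a \<Rightarrow> 'b" where
  "differential M f p v =
     (THE w. \<forall>\<gamma>. curve_with_velocity M p v \<gamma> \<longrightarrow> (f \<circ> \<gamma> has_vector_derivative w) (at 0))"

lemma differential_eq:
  assumes f: "(f has_derivative f') (at p)" and v: "v \<in> tangent_space M p"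
  shows "differential M f p v = f' v"
proof -
  have chain: "(f \<circ> \<gamma> has_vector_derivative f' v) (at 0)"
    if "curve_with_velocity M p v \<gamma>" for \<gamma>
  proof -
    from that have "\<gamma> 0 = p" and d: "(\<gamma> has_derivative (\<lambda>x. x *\<^sub>R v)) (at 0)"
      by (auto simp: curve_with_velocity_def has_vector_derivative_def)
    then have "(f \<circ> \<gamma> has_derivative f' \<circ> (\<lambda>x. x *\<^sub>R v)) (at 0)"
      using f by (intro diff_chain_at) auto
    then show ?thesis
      using linear_scale[OF has_derivative_linear[OF f]]
      by (simp add: has_vector_derivative_def o_def)
  qed
  obtain \<gamma> where "curve_with_velocity M p v \<gamma>"
    using v by (auto simp: tangent_space_def)
  then show ?thesis
    unfolding differential_def
    by (intro the_equality) (auto intro: chain vector_derivative_unique_at)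
qed

definition sq_moduli :: "complex^4^4 \<Rightarrow> real^4^4" where
  "sq_moduli U = (\<chi> i j. (cmod (U $ i $ j))\<^sup>2)"

definition B_star :: "real^4^4" where
  "B_star = (\<chi> i j. 1 / 4)"

text \<open>The elements of the index type \<open>4\<close> are the residues \<open>0, 1, 2, 3\<close>.\<close>

definition hyperplane :: "4 \<Rightarrow> 4 \<Rightarrow> (real^4^4) set" where
  "hyperplane r c = {B \<in> sums_one. B $ 0 $ 0 + B $ 0 $ c + B $ r $ 0 + B $ r $ c = 1}"

end

theory Submission
  imports Defs
begin

text \<open>
  (i) Perturb \<open>B_star\<close> along the line towards smaller \<open>B\<^sub>0\<^sub>0\<close> that is invariant under permutations
  of the remaining rows and columns. Dephasing a unitary matrix with such moduli so that its first row and
  column are positive leaves, up to scaling, a \<open>3 \<times> 3\<close> matrix of unimodular numbers with row sums \<open>-s\<close>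
  and with inner products \<open>-t\<close> of distinct rows, where \<open>0 < s < 1\<close> and \<open>t = (3 - s\<^sup>2) / 2 > 1\<close>.
  Its cofactors are proportional to \<open>t - s * cnj u\<close>, where \<open>u\<close> is the corresponding entry. On the
  other hand a cofactor is a difference \<open>x - y\<close> of unimodular numbers, so its conjugate is
  \<open>-(x - y) / (x y)\<close>. Multiplying these relations along a row shows that the products of the
  three rows are roots of one quadratic equation, hence two rows have the same product. Three
  unimodular numbers are determined up to order by their sum and product, so these two rows are
  permutations of each other, and then their inner product cannot be less than \<open>-1\<close>.

  (ii) Each row other than the first of the dephased core contains \<open>-1\<close>, and some column \<open>c\<close>
  contains it twice. With \<open>r\<close> the third row, the rows \<open>0, r\<close> are orthogonal to the other
  two already on the columns \<open>0, c\<close>. For a tangent vector \<open>A * U\<close> with \<open>A\<close> anti-Hermitian this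
  makes the derivative of the sum of the four squared moduli vanish.
\<close>

section \<open>Matrices of unimodular numbers with equal inner products\<close>

lemma quadratic_roots_not_pairwise_distinct:
  fixes x y z :: "'a::idom"
  assumes "a \<noteq> 0" "a * x^2 + b * x + c = 0" "a * y^2 + b * y + c = 0" "a * z^2 + b * z + c = 0"
  shows "x = y \<or> x = z \<or> y = z"
proof -
  have "(x - y) * (a * (x + y) + b) = 0" "(x - z) * (a * (x + z) + b) = 0"
    using assms(2-4) by algebra+
  then have "x = y \<or> x = z \<or> (a * (x + y) + b = 0 \<and> a * (x + z) + b = 0)"
    by auto
  moreover have "a * (y - z) = 0" if "a * (x + y) + b = 0" "a * (x + z) + b = 0"
    using that by algebra
  ultimately show ?thesis using assms(1) by auto
qed

text \<open>Both triples are the roots of the same monic cubic.\<close>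

lemma elementary_symmetric_eq_imp_permutation:
  fixes a1 a2 a3 b1 b2 b3 :: "'a::idom"
  assumes e1: "a1 + a2 + a3 = b1 + b2 + b3"
    and e2: "a1 * a2 + a2 * a3 + a3 * a1 = b1 * b2 + b2 * b3 + b3 * b1"
    and e3: "a1 * a2 * a3 = b1 * b2 * b3"
  shows "(b1, b2, b3) \<in> {(a1, a2, a3), (a1, a3, a2), (a2, a1, a3), (a2, a3, a1), (a3, a1, a2), (a3, a2, a1)}"
proof -
  have two: "(u = x \<and> v = y) \<or> (u = y \<and> v = x)"
    if "x + y = u + v" "x * y = u * v" for x y u v :: 'a
  proof -
    have "(u - x) * (u - y) = 0" using that by algebra
    then have "u = x \<or> u = y" by simp
    then show ?thesis using that(1) by auto
  qed
  have aux: "(b2 = y \<and> b3 = z) \<or> (b2 = z \<and> b3 = y)"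
    if "b1 = x" "x + y + z = b1 + b2 + b3" "x * y + y * z + z * x = b1 * b2 + b2 * b3 + b3 * b1" for x y z
    using two[of y z b2 b3] that by algebra
  have "(b1 - a1) * (b1 - a2) * (b1 - a3) = 0" using assms by algebra
  then have "b1 = a1 \<or> b1 = a2 \<or> b1 = a3" by simp
  then show ?thesis
  proof (elim disjE)
    assume "b1 = a1" then show ?thesis using aux[of a1 a2 a3] e1 e2 by auto
  next
    assume "b1 = a2" then show ?thesis using aux[of a2 a3 a1] e1 e2 by (auto simp: algebra_simps)
  next
    assume "b1 = a3" then show ?thesis using aux[of a3 a1 a2] e1 e2 by (auto simp: algebra_simps)
  qed
qed

text \<open>Since \<open>cnj a = 1 / a\<close>, the second symmetric function is determined by the
  sum and the product.\<close>

lemma unimodular_elementary_symmetric: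
  fixes a1 a2 a3 :: complex
  assumes "a1 * cnj a1 = 1" "a2 * cnj a2 = 1" "a3 * cnj a3 = 1"
  shows "a1 * a2 + a2 * a3 + a3 * a1 = cnj (a1 + a2 + a3) * (a1 * a2 * a3)"
  unfolding complex_cnj_add using assms by algebra

lemma unimodular_iff: "z * cnj z = 1 \<longleftrightarrow> cmod z = 1"
proof -
  have "z * cnj z = 1 \<longleftrightarrow> (cmod z)\<^sup>2 = 1"
    unfolding complex_norm_square[symmetric] using of_real_eq_1_iff by blast
  then show ?thesis by (simp add: abs_square_eq_1)
qed

text \<open>The mixed terms are conjugate, giving \<open>1 + 2 * Re (a * cnj b)\<close>. Such a sum
  is the inner product of a row with itself after swapping two entries.\<close>

lemma unimodular_ratio_sum_ge:
  fixes a b :: complex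
  assumes "a * cnj a = 1" "b * cnj b = 1" "1 + a * cnj b + b * cnj a = - of_real t"
  shows "t \<le> 1"
proof -
  have "cmod a = 1" "cmod b = 1"
    using assms(1,2) by (simp_all add: unimodular_iff)
  then have "\<bar>Re (a * cnj b)\<bar> \<le> 1"
    using abs_Re_le_cmod[of "a * cnj b"] by (simp add: norm_mult)
  moreover have "1 + 2 * Re (a * cnj b) = - t"
    using arg_cong[OF assms(3), of Re] by (simp add: algebra_simps)
  ultimately show ?thesis by linarith
qed

text \<open>Being real, the sum equals its conjugate; their difference is a Vandermonde product up
  to a unimodular factor, so two entries agree. It arises from rows that are cyclic shifts of each
  other.\<close>

lemma unimodular_cyclic_sum:
  fixes a1 a2 a3 :: complex
  assumes u: "a1 * cnj a1 = 1" "a2 * cnj a2 = 1" "a3 * cnj a3 = 1"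
    and c: "a1 * cnj a2 + a2 * cnj a3 + a3 * cnj a1 = - of_real t"
  shows "t \<le> 1"
proof -
  have c': "cnj a1 * a2 + cnj a2 * a3 + cnj a3 * a1 = - of_real t"
    using arg_cong[OF c, of cnj] by simp
  have "(a1 - a2) * (a2 - a3) * (a3 - a1) = 0"
    using u c c' by algebra
  then consider "a1 = a2" | "a2 = a3" | "a3 = a1" by auto
  then show ?thesis
  proof cases
    case 1 then show ?thesis using unimodular_ratio_sum_ge[OF u(2,3), of t] u c by simp
  next
    case 2 then show ?thesis using unimodular_ratio_sum_ge[OF u(3,1), of t] u c by (simp add: algebra_simps)
  next
    case 3 then show ?thesis using unimodular_ratio_sum_ge[OF u(1,2), of t] u c by (simp add: algebra_simps)
  qed
qed

text \<open>The rows are permutations of each other; the identity gives inner product 3, the other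
  five reduce to the two preceding bounds.\<close>

lemma equal_products_imp_le_1:
  fixes a1 a2 a3 b1 b2 b3 :: complex
  assumes ua: "a1 * cnj a1 = 1" "a2 * cnj a2 = 1" "a3 * cnj a3 = 1"
    and ub: "b1 * cnj b1 = 1" "b2 * cnj b2 = 1" "b3 * cnj b3 = 1"
    and sums: "a1 + a2 + a3 = b1 + b2 + b3"
    and prods: "a1 * a2 * a3 = b1 * b2 * b3"
    and inner: "a1 * cnj b1 + a2 * cnj b2 + a3 * cnj b3 = - of_real t"
  shows "t \<le> 1"
proof -
  have "a1 * a2 + a2 * a3 + a3 * a1 = b1 * b2 + b2 * b3 + b3 * b1"
    unfolding unimodular_elementary_symmetric[OF ua] unimodular_elementary_symmetric[OF ub]
      sums prods ..
  note elementary_symmetric_eq_imp_permutation[OF sums this prods]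
  then consider "b1 = a1" "b2 = a2" "b3 = a3" | "b1 = a1" "b2 = a3" "b3 = a2"
    | "b1 = a2" "b2 = a1" "b3 = a3" | "b1 = a2" "b2 = a3" "b3 = a1"
    | "b1 = a3" "b2 = a1" "b3 = a2" | "b1 = a3" "b2 = a2" "b3 = a1" by auto
  then show ?thesis
  proof cases
    case 1 then show ?thesis using inner ua by (auto simp: complex_eq_iff)
  next
    case 2 then show ?thesis using unimodular_ratio_sum_ge[OF ua(2,3), of t] ua inner by (simp add: algebra_simps)
  next
    case 3 then show ?thesis using unimodular_ratio_sum_ge[OF ua(1,2), of t] ua inner by (simp add: algebra_simps)
  next
    case 4 then show ?thesis using unimodular_cyclic_sum[OF ua, of t] inner by (simp add: algebra_simps)
  next
    case 5 then show ?thesis using unimodular_cyclic_sum[OF ua(1,3,2), of t] inner by (simp add: algebra_simps)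
  next
    case 6 then show ?thesis using unimodular_ratio_sum_ge[OF ua(3,1), of t] ua inner by (simp add: algebra_simps)
  qed
qed

section \<open>Cofactors of a matrix with equiangular rows\<close>

definition det3 :: "complex \<Rightarrow> complex \<Rightarrow> complex \<Rightarrow> complex \<Rightarrow> complex \<Rightarrow> complex \<Rightarrow> complex \<Rightarrow> complex \<Rightarrow> complex \<Rightarrow> complex" where
  "det3 a1 a2 a3 b1 b2 b3 c1 c2 c3 =
     a1 * (b2 * c3 - b3 * c2) + a2 * (b3 * c1 - b1 * c3) + a3 * (b1 * c2 - b2 * c1)"

text \<open>Multiply the identity \<open>adj M * M = det M\<close> on the right by the column of ones and
  by the conjugate transpose of \<open>M\<close>.\<close>

lemma cofactor_of_equiangular_rows:
  fixes s t :: real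
  assumes ua: "a1 * cnj a1 = 1" "a2 * cnj a2 = 1" "a3 * cnj a3 = 1"
    and sums: "a1 + a2 + a3 = - of_real s" "b1 + b2 + b3 = - of_real s" "c1 + c2 + c3 = - of_real s"
    and ba: "b1 * cnj a1 + b2 * cnj a2 + b3 * cnj a3 = - of_real t"
    and ca: "c1 * cnj a1 + c2 * cnj a2 + c3 * cnj a3 = - of_real t"
  shows "of_real (s * (3 + t)) * (b2 * c3 - b3 * c2)
    = - det3 a1 a2 a3 b1 b2 b3 c1 c2 c3 * (of_real t - of_real s * cnj a1)"
proof -
  define D where "D = det3 a1 a2 a3 b1 b2 b3 c1 c2 c3"
  \<comment> \<open>\<open>(m, n, p)\<close> is the first row of the adjugate of the matrix with
    rows a, b, c.\<close>
  define m n p where "m = b2 * c3 - b3 * c2" "n = c2 * a3 - c3 * a2" "p = a2 * b3 - a3 * b2"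
  have 1: "m * a1 + n * b1 + p * c1 = D" and 2: "m * a2 + n * b2 + p * c2 = 0"
    and 3: "m * a3 + n * b3 + p * c3 = 0"
    by (simp_all add: D_def m_n_p_def det3_def algebra_simps)
  have "- of_real s * (m + n + p) = m * (a1 + a2 + a3) + n * (b1 + b2 + b3) + p * (c1 + c2 + c3)"
    unfolding sums by (simp add: algebra_simps)
  also have "\<dots> = (m * a1 + n * b1 + p * c1) + (m * a2 + n * b2 + p * c2) + (m * a3 + n * b3 + p * c3)"
    by (simp add: algebra_simps)
  also have "\<dots> = D" unfolding 1 2 3 by simp
  finally have S: "- of_real s * (m + n + p) = D" .
  have "3 * m - of_real t * n - of_real t * p = D * cnj a1"
  proof -
    have "D * cnj a1 = (m * a1 + n * b1 + p * c1) * cnj a1 + (m * a2 + n * b2 + p * c2) * cnj a2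
        + (m * a3 + n * b3 + p * c3) * cnj a3"
      unfolding 1 2 3 by simp
    also have "\<dots> = m * (a1 * cnj a1 + a2 * cnj a2 + a3 * cnj a3)
        + n * (b1 * cnj a1 + b2 * cnj a2 + b3 * cnj a3) + p * (c1 * cnj a1 + c2 * cnj a2 + c3 * cnj a3)"
      by (simp add: algebra_simps)
    also have "\<dots> = 3 * m - of_real t * n - of_real t * p"
      unfolding ua ba ca by (simp add: algebra_simps)
    finally show ?thesis by simp
  qed
  \<comment> \<open>Eliminating \<open>n + p\<close> from the two linear relations leaves
    \<open>m\<close>.\<close>
  then show ?thesis using S unfolding D_def[symmetric] m_n_p_def(1)[symmetric] of_real_mult of_real_add of_real_numeral
    by algebra
qed


text \<open>For \<open>x = b2 * c3\<close> and \<open>y = b3 * c2\<close> this is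
  \<open>cnj (x - y) = 1 / x - 1 / y\<close> with denominators cleared.\<close>

lemma cnj_minor_of_unimodular:
  assumes "b2 * cnj b2 = 1" "b3 * cnj b3 = 1" "c2 * cnj c2 = 1" "c3 * cnj c3 = 1"
  shows "cnj (b2 * c3 - b3 * c2) * (b2 * b3 * c2 * c3) = - (b2 * c3 - b3 * c2)"
proof -
  have "cnj (b2 * c3 - b3 * c2) * (b2 * b3 * c2 * c3)
      = (b2 * cnj b2) * (c3 * cnj c3) * (b3 * c2) - (b3 * cnj b3) * (c2 * cnj c2) * (b2 * c3)"
    by (simp add: algebra_simps)
  then show ?thesis unfolding assms by simp
qed

text \<open>The first symmetric function is \<open>-s\<close> and, \<open>s\<close> being real, the
  second is \<open>-s\<close> times the third, so the product is affine in
  \<open>a1 * a2 * a3\<close>.\<close>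

lemma prod_shifted_unimodular:
  fixes s t :: real
  assumes ua: "a1 * cnj a1 = 1" "a2 * cnj a2 = 1" "a3 * cnj a3 = 1"
    and sum: "a1 + a2 + a3 = - of_real s"
  shows "(of_real t - of_real s * a1) * (of_real t - of_real s * a2) * (of_real t - of_real s * a3)
    = of_real (t^2 * (t + s^2)) - of_real (s^3 * (t + 1)) * (a1 * a2 * a3)"
proof -
  have e2: "a1 * a2 + a2 * a3 + a3 * a1 = - of_real s * (a1 * a2 * a3)"
    using unimodular_elementary_symmetric[OF ua] sum by simp
  have "(of_real t - of_real s * a1) * (of_real t - of_real s * a2) * (of_real t - of_real s * a3)
    = of_real t ^ 3 - of_real t ^ 2 * of_real s * (a1 + a2 + a3)
      + of_real t * of_real s ^ 2 * (a1 * a2 + a2 * a3 + a3 * a1) - of_real s ^ 3 * (a1 * a2 * a3)"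
    by (simp add: algebra_simps power2_eq_square power3_eq_cube)
  then show ?thesis unfolding e2 sum by (simp add: algebra_simps power2_eq_square power3_eq_cube)
qed

text \<open>The coefficients involve the rows only through \<open>D\<close> and \<open>W\<close>,
  which do not change when the rows are permuted cyclically. So the products of all three rows can
  be fed into this one equation.\<close>

lemma row_product_quadratic:
  fixes s t :: real
  assumes s: "0 < s" and t: "0 < t"
    and ua: "a1 * cnj a1 = 1" "a2 * cnj a2 = 1" "a3 * cnj a3 = 1"
    and ub: "b1 * cnj b1 = 1" "b2 * cnj b2 = 1" "b3 * cnj b3 = 1"
    and uc: "c1 * cnj c1 = 1" "c2 * cnj c2 = 1" "c3 * cnj c3 = 1"
    and sums: "a1 + a2 + a3 = - of_real s" "b1 + b2 + b3 = - of_real s" "c1 + c2 + c3 = - of_real s"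
    and ba: "b1 * cnj a1 + b2 * cnj a2 + b3 * cnj a3 = - of_real t"
    and ca: "c1 * cnj a1 + c2 * cnj a2 + c3 * cnj a3 = - of_real t"
  defines "D \<equiv> det3 a1 a2 a3 b1 b2 b3 c1 c2 c3"
    and "w \<equiv> a1 * a2 * a3"
    and "W \<equiv> (a1 * a2 * a3) * (b1 * b2 * b3) * (c1 * c2 * c3)"
    and "\<alpha> \<equiv> complex_of_real (t^2 * (t + s^2))" and "\<beta> \<equiv> complex_of_real (s^3 * (t + 1))"
  shows "D^3 * \<alpha> * w^2 + - (D^3 * \<beta> + cnj D^3 * W^2 * \<beta>) * w + cnj D^3 * W^2 * \<alpha> = 0"
proof -
  define k where "k = complex_of_real (s * (3 + t))"
  define T S where "T = complex_of_real t" "S = complex_of_real s"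
  have "s * (3 + t) \<noteq> 0" using s t by simp
  then have k: "k \<noteq> 0" "cnj k = k" unfolding k_def by (simp_all only: of_real_eq_0_iff complex_cnj_complex_of_real not_False_eq_True)
  have TS: "cnj T = T" "cnj S = S" by (simp_all add: T_S_def)
  define m1 m2 m3 where m: "m1 = b2 * c3 - b3 * c2" "m2 = b3 * c1 - b1 * c3" "m3 = b1 * c2 - b2 * c1"
  have M1: "k * m1 = - D * (T - S * cnj a1)"
    unfolding k_def D_def T_S_def m by (rule cofactor_of_equiangular_rows[OF ua sums ba ca])
  \<comment> \<open>The cofactors are written cyclically, so shifting the columns yields the other
    two without sign changes.\<close>
  have "k * m2 = - det3 a2 a3 a1 b2 b3 b1 c2 c3 c1 * (T - S * cnj a2)"
    unfolding k_def T_S_def m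
    by (rule cofactor_of_equiangular_rows) (use ua sums ba ca in \<open>simp_all add: algebra_simps\<close>)
  also have "det3 a2 a3 a1 b2 b3 b1 c2 c3 c1 = D" by (simp add: D_def det3_def algebra_simps)
  finally have M2: "k * m2 = - D * (T - S * cnj a2)" .
  have "k * m3 = - det3 a3 a1 a2 b3 b1 b2 c3 c1 c2 * (T - S * cnj a3)"
    unfolding k_def T_S_def m
    by (rule cofactor_of_equiangular_rows) (use ua sums ba ca in \<open>simp_all add: algebra_simps\<close>)
  also have "det3 a3 a1 a2 b3 b1 b2 c3 c1 c2 = D" by (simp add: D_def det3_def algebra_simps)
  finally have M3: "k * m3 = - D * (T - S * cnj a3)" .
  have P: "(T - S * a1) * (T - S * a2) * (T - S * a3) = \<alpha> - \<beta> * w"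
    unfolding T_S_def \<alpha>_def \<beta>_def w_def by (rule prod_shifted_unimodular[OF ua sums(1)])
  have P': "(T - S * cnj a1) * (T - S * cnj a2) * (T - S * cnj a3) = \<alpha> - \<beta> * cnj w"
    using arg_cong[OF P, of cnj] by (simp add: TS \<alpha>_def \<beta>_def)
  have prod: "k^3 * (m1 * m2 * m3) = - (D^3) * (\<alpha> - \<beta> * cnj w)"
  proof -
    have "k^3 * (m1 * m2 * m3) = (k * m1) * (k * m2) * (k * m3)"
      by (simp add: power3_eq_cube)
    also have "\<dots> = - (D^3) * ((T - S * cnj a1) * (T - S * cnj a2) * (T - S * cnj a3))"
      unfolding M1 M2 M3 by (simp add: power3_eq_cube)
    finally show ?thesis unfolding P' .
  qed
  have prod': "k^3 * cnj (m1 * m2 * m3) = - (cnj D^3) * (\<alpha> - \<beta> * w)"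
    using arg_cong[OF prod, of cnj] by (simp add: k \<alpha>_def \<beta>_def)
  \<comment> \<open>Across the three minors each entry of the rows b and c enters twice, which
    produces \<open>v^2\<close>.\<close>
  define v where "v = (b1 * b2 * b3) * (c1 * c2 * c3)"
  have "cnj m1 * (b2 * b3 * c2 * c3) = - m1" "cnj m2 * (b3 * b1 * c3 * c1) = - m2"
    "cnj m3 * (b1 * b2 * c1 * c2) = - m3"
    unfolding m by (intro cnj_minor_of_unimodular ub uc)+
  moreover have "cnj (m1 * m2 * m3) * v^2 = (cnj m1 * (b2 * b3 * c2 * c3))
      * (cnj m2 * (b3 * b1 * c3 * c1)) * (cnj m3 * (b1 * b2 * c1 * c2))"
    by (simp add: v_def power2_eq_square)
  ultimately have "cnj (m1 * m2 * m3) * v^2 = - (m1 * m2 * m3)" by simp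
  then have "k^3 * cnj (m1 * m2 * m3) * v^2 = - (k^3 * (m1 * m2 * m3))"
    by (metis mult.assoc mult_minus_right)
  then have *: "- (cnj D^3) * (\<alpha> - \<beta> * w) * v^2 = D^3 * (\<alpha> - \<beta> * cnj w)"
    unfolding prod prod' by simp
  have w1: "w * cnj w = 1"
    using ua unfolding unimodular_iff by (simp add: w_def norm_mult)
  \<comment> \<open>Multiplying by \<open>w^2\<close> replaces \<open>v\<close>, which depends on
    the chosen row, by the symmetric \<open>W\<close>, and \<open>w * cnj w = 1\<close> removes
    \<open>cnj w\<close>.\<close>
  have W: "W = w * v" by (simp add: W_def w_def v_def)
  have "- (cnj D^3) * (\<alpha> - \<beta> * w) * W^2 = - (cnj D^3) * (\<alpha> - \<beta> * w) * v^2 * w^2"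
    by (simp add: W power2_eq_square)
  also have "\<dots> = D^3 * (\<alpha> * w^2 - \<beta> * w * (w * cnj w))"
    unfolding * by (simp add: algebra_simps power2_eq_square)
  finally show ?thesis unfolding w1 by (simp add: algebra_simps)
qed

lemma no_equiangular_unimodular_3x3:
  fixes s t :: real
  assumes s: "0 < s" and t: "1 < t" "t < 3"
    and ua: "a1 * cnj a1 = 1" "a2 * cnj a2 = 1" "a3 * cnj a3 = 1"
    and ub: "b1 * cnj b1 = 1" "b2 * cnj b2 = 1" "b3 * cnj b3 = 1"
    and uc: "c1 * cnj c1 = 1" "c2 * cnj c2 = 1" "c3 * cnj c3 = 1"
    and sums: "a1 + a2 + a3 = - of_real s" "b1 + b2 + b3 = - of_real s" "c1 + c2 + c3 = - of_real s"
    and ab: "a1 * cnj b1 + a2 * cnj b2 + a3 * cnj b3 = - of_real t"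
    and bc: "b1 * cnj c1 + b2 * cnj c2 + b3 * cnj c3 = - of_real t"
    and ca: "c1 * cnj a1 + c2 * cnj a2 + c3 * cnj a3 = - of_real t"
  shows False
proof -
  have ba: "b1 * cnj a1 + b2 * cnj a2 + b3 * cnj a3 = - of_real t"
    using arg_cong[OF ab, of cnj] by (simp add: mult.commute)
  have cb: "c1 * cnj b1 + c2 * cnj b2 + c3 * cnj b3 = - of_real t"
    using arg_cong[OF bc, of cnj] by (simp add: mult.commute)
  have ac: "a1 * cnj c1 + a2 * cnj c2 + a3 * cnj c3 = - of_real t"
    using arg_cong[OF ca, of cnj] by (simp add: mult.commute)
  define D where "D = det3 a1 a2 a3 b1 b2 b3 c1 c2 c3"
  define W where "W = (a1 * a2 * a3) * (b1 * b2 * b3) * (c1 * c2 * c3)"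
  have Db: "det3 b1 b2 b3 c1 c2 c3 a1 a2 a3 = D" and Dc: "det3 c1 c2 c3 a1 a2 a3 b1 b2 b3 = D"
    by (simp_all add: D_def det3_def algebra_simps)
  have Wb: "(b1 * b2 * b3) * (c1 * c2 * c3) * (a1 * a2 * a3) = W"
    and Wc: "(c1 * c2 * c3) * (a1 * a2 * a3) * (b1 * b2 * b3) = W"
    by (simp_all add: W_def)
  have t0: "0 < t" using t by simp
  note row_product_quadratic[OF s t0 ua ub uc sums ba ca, folded D_def W_def]
    row_product_quadratic[OF s t0 ub uc ua sums(2,3,1) cb ab, unfolded Db Wb]
    row_product_quadratic[OF s t0 uc ua ub sums(3,1,2) ac bc, unfolded Dc Wc]
  note q = this
  \<comment> \<open>This keeps the leading coefficient nonzero. If \<open>D = 0\<close>, rows b and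
    c would be proportional, so their inner product would have modulus 3, whereas
    \<open>t < 3\<close>.\<close>
  have "D \<noteq> 0"
  proof
    assume D: "D = 0"
    have "s * (3 + t) \<noteq> 0" using s t by simp
    then have k: "complex_of_real (s * (3 + t)) \<noteq> 0" by (simp only: of_real_eq_0_iff not_False_eq_True)
    have "b2 * c3 - b3 * c2 = 0"
      using cofactor_of_equiangular_rows[OF ua sums ba ca, folded D_def] D k by simp
    moreover have "b3 * c1 - b1 * c3 = 0"
    proof -
      have "of_real (s * (3 + t)) * (b3 * c1 - b1 * c3) = - det3 a2 a3 a1 b2 b3 b1 c2 c3 c1 * (of_real t - of_real s * cnj a2)"
        by (rule cofactor_of_equiangular_rows) (use ua sums ba ca in \<open>simp_all add: algebra_simps\<close>)
      also have "det3 a2 a3 a1 b2 b3 b1 c2 c3 c1 = D" by (simp add: D_def det3_def algebra_simps)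
      finally show ?thesis using D k by simp
    qed
    ultimately have p: "b2 * c3 = b3 * c2" "b1 * c3 = b3 * c1" by auto
    have "c3 * (b1 * cnj c1 + b2 * cnj c2 + b3 * cnj c3)
        = (b1 * c3) * cnj c1 + (b2 * c3) * cnj c2 + b3 * c3 * cnj c3"
      by (simp add: algebra_simps)
    also have "\<dots> = b3 * (c1 * cnj c1) + b3 * (c2 * cnj c2) + b3 * (c3 * cnj c3)"
      unfolding p by (simp add: algebra_simps)
    also have "\<dots> = 3 * b3" unfolding uc by simp
    finally have "cmod (c3 * - of_real t) = cmod (3 * b3)" unfolding bc by simp
    then show False using ub uc t by (simp add: norm_mult unimodular_iff)
  qed
  moreover have "t^2 * (t + s^2) > 0"
    using t0 by (intro mult_pos_pos add_pos_nonneg) simp_all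
  then have "complex_of_real (t^2 * (t + s^2)) \<noteq> 0"
    by (simp only: of_real_eq_0_iff)
  ultimately have "D^3 * complex_of_real (t^2 * (t + s^2)) \<noteq> 0" by simp
  from quadratic_roots_not_pairwise_distinct[OF this q]
  consider "a1 * a2 * a3 = b1 * b2 * b3" | "a1 * a2 * a3 = c1 * c2 * c3" | "b1 * b2 * b3 = c1 * c2 * c3"
    by blast
  then have "t \<le> 1"
  proof cases
    case 1 then show ?thesis by (intro equal_products_imp_le_1[OF ua ub _ _ ab]) (simp_all add: sums)
  next
    case 2 then show ?thesis by (intro equal_products_imp_le_1[OF ua uc _ _ ac]) (simp_all add: sums)
  next
    case 3 then show ?thesis by (intro equal_products_imp_le_1[OF ub uc _ _ bc]) (simp_all add: sums)
  qed
  then show False using t by simp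
qed

section \<open>Bistochastic matrices near the centre\<close>

lemma sum_UNIV_4: "sum f (UNIV :: 4 set) = f 0 + f 1 + f 2 + f 3"
proof -
  have "(4::4) = 0" by simp
  then have "f 4 = f 0" by (rule arg_cong)
  then show ?thesis unfolding sum_4 by (simp add: ac_simps)
qed

lemma nonzero_4: "- {0::4} = {1, 2, 3}"
proof -
  have "(4::4) = 0" by simp
  then have "UNIV = {0::4, 1, 2, 3}" unfolding UNIV_4 by auto
  then show ?thesis by auto
qed

section \<open>Orthogonality relations and dephasing\<close>

lemma unitary_rows:
  assumes "U \<in> unitary_group"
  shows "(\<Sum>j\<in>UNIV. U $ i $ j * cnj (U $ k $ j)) = (if i = k then 1 else 0)"
  using assms unfolding unitary_group_def
  by (auto simp: vec_eq_iff matrix_matrix_mult_def conj_transpose_def mat_def)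

lemma unitary_columns:
  assumes "U \<in> unitary_group"
  shows "(\<Sum>i\<in>UNIV. cnj (U $ i $ j) * U $ i $ k) = (if j = k then 1 else 0)"
  using assms unfolding unitary_group_def
  by (auto simp: vec_eq_iff matrix_matrix_mult_def conj_transpose_def mat_def)

lemma transpose_in_unitary_group:
  assumes "U \<in> unitary_group"
  shows "transpose U \<in> unitary_group"
  unfolding unitary_group_def
  using unitary_rows[OF assms] unitary_columns[OF assms]
  by (auto simp: vec_eq_iff matrix_matrix_mult_def conj_transpose_def mat_def transpose_def mult.commute)

text \<open>Dividing by the entries themselves, not only by their phases, makes the first row and
  column equal to 1 where the entries are nonzero.\<close>

definition dephased :: "complex^4^4 \<Rightarrow> 4 \<Rightarrow> 4 \<Rightarrow> complex" where
  "dephased U i j = U $ i $ j * U $ 0 $ 0 / (U $ i $ 0 * U $ 0 $ j)"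

text \<open>By orthogonality of the rows, the sum over the columns other than 0 is minus the term at
  column 0, which the normalisation cancels; the moduli in row 0 leave the factor
  \<open>p / q\<close>.\<close>

lemma dephased_mult_cnj:
  fixes U :: "complex^4^4"
  assumes "U \<in> unitary_group" and p: "(cmod (U $ 0 $ 0))\<^sup>2 = p"
    and q: "\<And>j. j \<noteq> 0 \<Longrightarrow> (cmod (U $ 0 $ j))\<^sup>2 = q" and "q \<noteq> 0"
    and nz: "U $ k $ 0 \<noteq> 0" "U $ l $ 0 \<noteq> 0" and "k \<noteq> l"
  shows "(\<Sum>j\<in>-{0}. dephased U k j * cnj (dephased U l j)) = - of_real (p / q)"
proof -
  have p': "U $ 0 $ 0 * cnj (U $ 0 $ 0) = of_real p" using p by (simp add: complex_norm_square[symmetric])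
  have q': "U $ 0 $ j * cnj (U $ 0 $ j) = of_real q" if "j \<noteq> 0" for j
    using q[OF that] by (simp add: complex_norm_square[symmetric])
  have "(\<Sum>j\<in>-{0}. dephased U k j * cnj (dephased U l j))
      = (\<Sum>j\<in>-{0}. of_real (p / q) / (U $ k $ 0 * cnj (U $ l $ 0)) * (U $ k $ j * cnj (U $ l $ j)))"
  proof (rule sum.cong)
    fix j :: 4 assume "j \<in> -{0}"
    then have "U $ 0 $ j * cnj (U $ 0 $ j) = of_real q" using q' by simp
    have "dephased U k j * cnj (dephased U l j)
      = (U $ 0 $ 0 * cnj (U $ 0 $ 0)) / (U $ 0 $ j * cnj (U $ 0 $ j)) / (U $ k $ 0 * cnj (U $ l $ 0)) * (U $ k $ j * cnj (U $ l $ j))"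
      by (simp add: dephased_def mult_ac)
    then show "dephased U k j * cnj (dephased U l j) =
         of_real (p / q) / (U $ k $ 0 * cnj (U $ l $ 0)) * (U $ k $ j * cnj (U $ l $ j))"
      unfolding p' \<open>U $ 0 $ j * cnj (U $ 0 $ j) = of_real q\<close> by simp
  qed simp
  also have "\<dots> = of_real (p / q) / (U $ k $ 0 * cnj (U $ l $ 0)) * (\<Sum>j\<in>-{0}. U $ k $ j * cnj (U $ l $ j))"
    by (rule sum_distrib_left[symmetric])
  also have "(\<Sum>j\<in>-{0}. U $ k $ j * cnj (U $ l $ j)) = - (U $ k $ 0 * cnj (U $ l $ 0))"
    using unitary_rows[OF assms(1), of k l] \<open>k \<noteq> l\<close>
    by (simp add: Compl_eq_Diff_UNIV sum_diff1)
  finally show ?thesis using nz by simp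
qed

text \<open>Row 0 of the dephased matrix consists of ones, so a row sum is an inner product with
  it.\<close>

lemma dephased_row_sum:
  fixes U :: "complex^4^4"
  assumes "U \<in> unitary_group" and p: "(cmod (U $ 0 $ 0))\<^sup>2 = p" "p \<noteq> 0"
    and q: "\<And>j. j \<noteq> 0 \<Longrightarrow> (cmod (U $ 0 $ j))\<^sup>2 = q" "q \<noteq> 0"
    and nz: "U $ k $ 0 \<noteq> 0" and "k \<noteq> 0"
  shows "(\<Sum>j\<in>-{0}. dephased U k j) = - of_real (p / q)"
proof -
  have "U $ 0 $ 0 \<noteq> 0" using p by auto
  moreover have "U $ 0 $ j \<noteq> 0" if "j \<noteq> 0" for j using q that by force
  ultimately have "dephased U 0 j = 1" if "j \<noteq> 0" for j using that by (simp add: dephased_def)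
  then show ?thesis
    using dephased_mult_cnj[OF assms(1) p(1) q nz \<open>U $ 0 $ 0 \<noteq> 0\<close> \<open>k \<noteq> 0\<close>] by simp
qed

text \<open>The matrix invariant under permutations of the indices \<open>1, 2, 3\<close> whose dephased core, scaled to be unimodular,
  would have row sums \<open>-s\<close>; the entries are in the ratio \<open>s\<^sup>2 : t : 1\<close> with \<open>t = (3 - s\<^sup>2) / 2\<close>.\<close>

definition perturbed :: "real \<Rightarrow> real^4^4" where
  "perturbed s = (\<chi> i j. (if i = 0 \<and> j = 0 then s\<^sup>2
     else if i = 0 \<or> j = 0 then (3 - s\<^sup>2) / 2 else 1) / ((3 - s\<^sup>2) / 2 + 3))"

lemma bistochastic_perturbed:
  assumes "0 < s" "s < 1"
  shows "bistochastic (perturbed s)"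
proof -
  define t where "t = (3 - s\<^sup>2) / 2"
  have "s\<^sup>2 < 1" using assms by (simp add: power_less_one_iff)
  then have t: "0 \<le> t" "0 < t + 3" by (simp add: t_def) (use \<open>s\<^sup>2 < 1\<close> in \<open>simp add: t_def field_simps\<close>)
  have s: "s\<^sup>2 = 3 - 2 * t" by (simp add: t_def field_simps)
  have d: "0 \<le> 3 - 2 * t" using zero_le_power2[of s] unfolding s .
  have "(3 - 2 * t) / (t + 3) + t / (t + 3) + t / (t + 3) + t / (t + 3) = 1"
    "t / (t + 3) + 1 / (t + 3) + 1 / (t + 3) + 1 / (t + 3) = 1"
    unfolding add_divide_distrib[symmetric] using t by simp_all
  then show ?thesis
    unfolding bistochastic_def perturbed_def t_def[symmetric] unfolding s
    using t d by (simp add: sum_UNIV_4)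
qed

lemma not_unistochastic_perturbed:
  assumes s: "0 < s" "s < 1"
  shows "\<not> unistochastic (perturbed s)"
proof
  assume "unistochastic (perturbed s)"
  then obtain U where U: "U \<in> unitary_group" and B: "\<And>i j. perturbed s $ i $ j = (cmod (U $ i $ j))\<^sup>2"
    unfolding unistochastic_def by auto
  have s2: "s\<^sup>2 < 1" "0 < s\<^sup>2" using s by (simp_all add: power_less_one_iff)
  define t where "t = (3 - s\<^sup>2) / 2"
  have "1 < (3 - x) / 2" "(3 - x) / 2 < 3" if "0 < x" "x < 1" for x :: real
    using that by (simp_all add: field_simps)
  then have t: "1 < t" "t < 3" unfolding t_def using s2 by blast+
  define p q where pq: "p = s\<^sup>2 / (t + 3)" "q = t / (t + 3)"
  have "t + 3 \<noteq> 0" using t by simp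
  then have p0: "p \<noteq> 0" unfolding pq using s by simp
  have p: "(cmod (U $ 0 $ 0))\<^sup>2 = p"
    using B[of 0 0] by (simp add: perturbed_def t_def[symmetric] pq)
  have q: "(cmod (U $ 0 $ j))\<^sup>2 = q" "(cmod (U $ j $ 0))\<^sup>2 = q" if "j \<noteq> 0" for j
    using B[of 0 j] B[of j 0] that by (simp_all add: perturbed_def t_def[symmetric] pq)
  have r: "(cmod (U $ i $ j))\<^sup>2 = 1 / (t + 3)" if "i \<noteq> 0" "j \<noteq> 0" for i j
    using B[of i j] that by (simp add: perturbed_def t_def[symmetric])
  have q0: "q \<noteq> 0" using t by (simp add: pq)
  have nz: "U $ j $ 0 \<noteq> 0" if "j \<noteq> 0" for j using q(2)[OF that] q0 by auto
  have pdq: "p / q = s\<^sup>2 / t" using t by (simp add: pq)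
  \<comment> \<open>Core entries have squared modulus
    \<open>p / ((t + 3) * q^2) = (s / t)^2\<close>, hence the factor \<open>t / s\<close>. As
    \<open>p / q = s^2 / t\<close>, the row sums become \<open>-s\<close> and the inner products
    \<open>-t\<close>.\<close>
  define x where "x k j = complex_of_real (t / s) * dephased U k j" for k j
  have unimod: "x k j * cnj (x k j) = 1" if "k \<noteq> 0" "j \<noteq> 0" for k j
  proof -
    have "(cmod (x k j))\<^sup>2 = (t / s)\<^sup>2 * (1 / (t + 3)) * p / (q * q)"
      by (simp add: x_def dephased_def norm_mult norm_divide power_mult_distrib power_divide p q r that)
    also have "\<dots> = 1"
    proof -
      have "(t / s)\<^sup>2 * (1 / v) * (s\<^sup>2 / v) / (t / v * (t / v)) = 1" if "v \<noteq> 0" for v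
        using that s t by (simp add: field_simps power2_eq_square)
      then show ?thesis unfolding pq using \<open>t + 3 \<noteq> 0\<close> by blast
    qed
    finally show ?thesis unfolding unimodular_iff by (simp add: abs_square_eq_1)
  qed
  have sums: "x k 1 + x k 2 + x k 3 = - of_real s" if "k \<noteq> 0" for k
  proof -
    have "x k 1 + x k 2 + x k 3 = of_real (t / s) * (\<Sum>j\<in>-{0}. dephased U k j)"
      by (simp add: nonzero_4 x_def algebra_simps)
    also have "(\<Sum>j\<in>-{0}. dephased U k j) = - of_real (s\<^sup>2 / t)"
      using dephased_row_sum[OF U p p0 q(1) q0 nz[OF that] that] unfolding pdq .
    also have "complex_of_real (t / s) * - of_real (s\<^sup>2 / t) = - of_real (t / s * (s\<^sup>2 / t))"
      by (simp only: of_real_mult mult_minus_right)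
    also have "t / s * (s\<^sup>2 / t) = s" using s t by (simp add: power2_eq_square)
    finally show ?thesis .
  qed
  have inner: "x k 1 * cnj (x l 1) + x k 2 * cnj (x l 2) + x k 3 * cnj (x l 3) = - of_real t"
    if "k \<noteq> 0" "l \<noteq> 0" "k \<noteq> l" for k l
  proof -
    have "x k 1 * cnj (x l 1) + x k 2 * cnj (x l 2) + x k 3 * cnj (x l 3)
        = of_real ((t / s)\<^sup>2) * (\<Sum>j\<in>-{0}. dephased U k j * cnj (dephased U l j))"
      by (simp add: nonzero_4 x_def algebra_simps power2_eq_square)
    also have "(\<Sum>j\<in>-{0}. dephased U k j * cnj (dephased U l j)) = - of_real (s\<^sup>2 / t)"
      using dephased_mult_cnj[OF U p q(1) q0 nz[OF that(1)] nz[OF that(2)] that(3)] unfolding pdq .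
    also have "complex_of_real ((t / s)\<^sup>2) * - of_real (s\<^sup>2 / t) = - of_real ((t / s)\<^sup>2 * (s\<^sup>2 / t))"
      by (simp only: of_real_mult mult_minus_right)
    also have "(t / s)\<^sup>2 * (s\<^sup>2 / t) = t" using s t by (simp add: power2_eq_square)
    finally show ?thesis .
  qed
  show False
    by (rule no_equiangular_unimodular_3x3[OF s(1) t,
          of "x 1 1" "x 1 2" "x 1 3" "x 2 1" "x 2 2" "x 2 3" "x 3 1" "x 3 2" "x 3 3"])
       (simp_all add: unimod sums inner)
qed

text \<open>At \<open>s = 1\<close> all three kinds of entries equal \<open>1 / 4\<close>. The limit
  is one-sided because the obstruction is established for \<open>0 < s < 1\<close>.\<close>

lemma perturbed_tendsto_B_star: "(perturbed \<longlongrightarrow> B_star) (at_left 1)"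
proof (intro vec_tendstoI)
  fix i j :: 4
  have num: "((\<lambda>s::real. if i = 0 \<and> j = 0 then s\<^sup>2 else if i = 0 \<or> j = 0 then (3 - s\<^sup>2) / 2 else 1)
      \<longlongrightarrow> 1) (at_left 1)"
    by (cases "i = 0 \<and> j = 0"; cases "i = 0 \<or> j = 0") (auto intro!: tendsto_eq_intros)
  have "((\<lambda>s::real. (3 - s\<^sup>2) / 2 + 3) \<longlongrightarrow> 4) (at_left 1)"
    by (auto intro!: tendsto_eq_intros)
  from tendsto_divide[OF num this]
  show "((\<lambda>s. perturbed s $ i $ j) \<longlongrightarrow> B_star $ i $ j) (at_left 1)"
    by (simp add: perturbed_def B_star_def)
qed

lemma nbhd_contains_non_unistochastic:
  assumes "nbhd_in_sums_one N B_star"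
  shows "\<exists>B\<in>N. bistochastic B \<and> \<not> unistochastic B"
proof -
  obtain e where e: "e > 0" "\<And>B. B \<in> sums_one \<Longrightarrow> mat_dist B_star B < e \<Longrightarrow> B \<in> N"
    using assms unfolding nbhd_in_sums_one_def by blast
  have "\<forall>\<^sub>F s in at_left 1. dist (perturbed s) B_star < e"
    using perturbed_tendsto_B_star e(1) by (rule tendstoD)
  moreover have "\<forall>\<^sub>F s::real in at_left 1. s \<in> {0<..<1}"
    by (intro eventually_at_left_real) simp
  ultimately have "\<forall>\<^sub>F s::real in at_left 1. dist (perturbed s) B_star < e \<and> s \<in> {0<..<1}"
    by (rule eventually_conj)
  then obtain s where s: "dist (perturbed s) B_star < e" "0 < s" "s < 1"
    using eventually_happens'[OF trivial_limit_at_left_real] by (metis (no_types, lifting) greaterThanLessThan_iff)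
  have "perturbed s \<in> sums_one"
    using bistochastic_perturbed[OF s(2,3)] by (simp add: bistochastic_def sums_one_def)
  with e(2) s(1) have "perturbed s \<in> N" by (simp add: mat_dist_eq_dist dist_commute)
  then show ?thesis using bistochastic_perturbed not_unistochastic_perturbed s(2,3) by blast
qed

section \<open>The differential at a complex Hadamard matrix\<close>

text \<open>The second symmetric function is minus the third, so \<open>-1\<close> is a root of the
  cubic with roots \<open>a\<close>, \<open>b\<close>, \<open>c\<close>.\<close>

lemma unimodular_triple_has_minus_one:
  fixes a b c :: complex
  assumes "a * cnj a = 1" "b * cnj b = 1" "c * cnj c = 1" and sum: "a + b + c = -1"
  shows "a = -1 \<or> b = -1 \<or> c = -1"
proof -
  have e2: "a * b + b * c + c * a = - (a * b * c)"
    using unimodular_elementary_symmetric[OF assms(1-3)] sum by simp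
  have "(a + 1) * (b + 1) * (c + 1) = (a * b + b * c + c * a) + a * b * c + (a + b + c) + 1"
    by (simp add: algebra_simps)
  also have "\<dots> = 0" unfolding e2 sum by simp
  finally show ?thesis by (simp add: add_eq_0_iff2)
qed

text \<open>The rows are \<open>(-1, a2, -a2)\<close> and \<open>(b1, -1, -b1)\<close>, and the
  condition on their inner product factors as \<open>(a2 - 1) * (cnj b1 - 1) = 0\<close>.\<close>

lemma third_column_has_minus_one:
  fixes a2 a3 b1 b3 :: complex
  assumes "-1 + a2 + a3 = -1" "b1 + -1 + b3 = -1"
    and "-1 * cnj b1 + a2 * cnj (-1) + a3 * cnj b3 = -1"
  shows "a3 = -1 \<or> b3 = -1"
proof -
  have "a3 = - a2" "b3 = - b1" using assms(1,2) by (simp_all add: algebra_simps add_eq_0_iff)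
  then have "(a2 - 1) * (cnj b1 - 1) = 0" using assms(3) by (simp add: algebra_simps)
  then have "a2 = 1 \<or> cnj b1 = cnj 1" by simp
  then show ?thesis using \<open>a3 = - a2\<close> \<open>b3 = - b1\<close> unfolding complex_cnj_cancel_iff by auto
qed

text \<open>Each of the three rows contains \<open>-1\<close>. If these lie in three different
  columns, rows 1 and 2 force a further \<open>-1\<close> in the column where row 3 has one.\<close>

lemma column_with_two_minus_ones:
  fixes d :: "4 \<Rightarrow> 4 \<Rightarrow> complex"
  assumes u: "\<And>k j. d k j * cnj (d k j) = 1"
    and sums: "\<And>k. k \<noteq> 0 \<Longrightarrow> (\<Sum>j\<in>-{0}. d k j) = -1"
    and inner: "\<And>k l. k \<noteq> 0 \<Longrightarrow> l \<noteq> 0 \<Longrightarrow> k \<noteq> l \<Longrightarrow> (\<Sum>j\<in>-{0}. d k j * cnj (d l j)) = -1"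
  obtains c k l where "c \<noteq> 0" "k \<noteq> 0" "l \<noteq> 0" "k \<noteq> l" "d k c = -1" "d l c = -1"
proof -
  have ex: "\<exists>c. c \<noteq> 0 \<and> d k c = -1" if "k \<noteq> 0" for k
    using unimodular_triple_has_minus_one[OF u[of k 1] u[of k 2] u[of k 3]] sums[OF that]
    by (force simp: nonzero_4 add.assoc)
  obtain x where x: "x \<noteq> 0" "d 1 x = -1" using ex[of 1] by auto
  obtain y where y: "y \<noteq> 0" "d 2 y = -1" using ex[of 2] by auto
  obtain z where z: "z \<noteq> 0" "d 3 z = -1" using ex[of 3] by auto
  show thesis
  proof (cases "x = y \<or> x = z \<or> y = z")
    case True
    then show thesis using that[of x 1 2] that[of x 1 3] that[of y 2 3] x y z by auto
  next
    case False
    have "card {x, y, z} = card (-{0::4})" using False by (simp add: nonzero_4)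
    then have "-{0} = {x, y, z}" using x y z
      by (metis card_subset_eq finite empty_subsetI insert_subset ComplI singletonD)
    then have "d 1 z = -1 \<or> d 2 z = -1"
      using third_column_has_minus_one[of "d 1 y" "d 1 z" "d 2 x" "d 2 z"]
        sums[of 1] sums[of 2] inner[of 1 2] False x y by (simp add: algebra_simps)
    then show thesis using that[of z 1 3] that[of z 2 3] z by auto
  qed
qed

lemma dephased_transpose: "dephased (transpose U) i j = dephased U j i"
  by (simp add: dephased_def transpose_def mult.commute)

lemma hadamard_block_orthogonal:
  fixes U :: "complex^4^4"
  assumes U: "U \<in> unitary_group" and flat: "\<And>i j. (cmod (U $ i $ j))\<^sup>2 = 1 / 4"
  obtains r c where "r \<noteq> 0" "c \<noteq> 0"
    "\<And>i k. i \<in> {0, r} \<Longrightarrow> k \<notin> {0, r} \<Longrightarrow> (\<Sum>j\<in>{0, c}. cnj (U $ i $ j) * U $ k $ j) = 0"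
proof -
  define d where "d = dephased U"
  have nz: "U $ i $ j \<noteq> 0" for i j using flat[of i j] by auto
  have cm: "cmod (U $ i $ j) = 1 / 2" for i j
    using real_sqrt_unique[OF flat[of i j]] by (simp add: real_sqrt_divide)
  have unimod: "d k j * cnj (d k j) = 1" for k j
    unfolding unimodular_iff by (simp add: d_def dephased_def norm_mult norm_divide cm)
  have sums: "(\<Sum>j\<in>-{0}. d k j) = -1" if "k \<noteq> 0" for k
    using dephased_row_sum[OF U flat _ flat _ nz that] by (simp add: d_def)
  have inner: "(\<Sum>j\<in>-{0}. d k j * cnj (d l j)) = -1" if "k \<noteq> 0" "l \<noteq> 0" "k \<noteq> l" for k l
    using dephased_mult_cnj[OF U flat flat _ nz nz that(3)] by (simp add: d_def)
  obtain c k l where ckl: "c \<noteq> 0" "k \<noteq> 0" "l \<noteq> 0" "k \<noteq> l" "d k c = -1" "d l c = -1"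
    using column_with_two_minus_ones[of d, OF unimod sums inner] by blast
  have "card (-{0} - {k, l}) = card (-{0::4}) - card {k, l}"
    using ckl by (intro card_Diff_subset) auto
  then have "card (-{0} - {k, l}) = 1" using \<open>k \<noteq> l\<close> by (simp add: nonzero_4)
  then obtain r where r: "-{0} - {k, l} = {r}" by (auto simp: card_1_singleton_iff)
  \<comment> \<open>The transpose is unitary and flat too, so the columns of the core also sum to
    \<open>-1\<close>; the two entries \<open>-1\<close> in column \<open>c\<close> then force the
    entry in row \<open>r\<close> to be 1.\<close>
  have col: "(\<Sum>i\<in>-{0}. d i c) = -1"
    using dephased_row_sum[OF transpose_in_unitary_group[OF U], of "1/4" "1/4" c] flat nz ckl
    by (simp add: d_def dephased_transpose) (simp add: transpose_def)
  have eq: "-{0} = {k, l, r}" and r0: "r \<noteq> 0" "r \<noteq> k" "r \<noteq> l" using r ckl by auto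
  have "d r c = 1" using col ckl r0 unfolding eq by simp
  moreover have "d 0 c = 1" using nz by (simp add: d_def dephased_def)
  ultimately have one: "d i c = 1" if "i \<in> {0, r}" for i using that by auto
  have minus: "d i c = -1" if "i \<notin> {0, r}" for i
  proof -
    have "i \<in> {k, l, r}" using that unfolding eq[symmetric] by simp
    then show ?thesis using that ckl by auto
  qed
  \<comment> \<open>Passing from column 0 to column \<open>c\<close> multiplies rows
    \<open>0, r\<close> and the other two rows by opposite factors of modulus 1, so the two terms
    cancel.\<close>
  have "(\<Sum>j\<in>{0, c}. cnj (U $ i $ j) * U $ k $ j) = 0" if "i \<in> {0, r}" "k \<notin> {0, r}" for i k
  proof -
    have "U $ i $ c = U $ i $ 0 * U $ 0 $ c / U $ 0 $ 0"
      using one[OF that(1)] nz by (simp add: d_def dephased_def field_simps)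
    moreover have "U $ k $ c = - (U $ k $ 0 * U $ 0 $ c / U $ 0 $ 0)"
      using minus[OF that(2)] nz by (simp add: d_def dephased_def field_simps eq_neg_iff_add_eq_0)
    ultimately have "cnj (U $ i $ c) * U $ k $ c
        = - (cnj (U $ i $ 0) * U $ k $ 0) * ((U $ 0 $ c * cnj (U $ 0 $ c)) / (U $ 0 $ 0 * cnj (U $ 0 $ 0)))"
      by (simp add: mult_ac)
    also have "\<dots> = - (cnj (U $ i $ 0) * U $ k $ 0)"
      unfolding complex_norm_square[symmetric] flat by simp
    finally show ?thesis using ckl(1) by simp
  qed
  then show thesis using that r0(1) ckl(1) by blast
qed

section \<open>Tangent vectors to the unitary group\<close>

text \<open>Differentiating the orthonormality of the rows along a curve shows that
  \<open>V * U\<^sup>*\<close> is anti-Hermitian.\<close>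

lemma tangent_unitary_group:
  fixes U :: "complex^'n^'n"
  assumes "V \<in> tangent_space unitary_group U"
  shows "(\<Sum>j\<in>UNIV. V $ i $ j * cnj (U $ k $ j)) = - cnj (\<Sum>j\<in>UNIV. V $ k $ j * cnj (U $ i $ j))"
proof -
  obtain \<gamma> e where e: "e > 0" and \<gamma>: "\<gamma> ` {-e<..<e} \<subseteq> unitary_group" "\<gamma> 0 = U"
    and deriv: "(\<gamma> has_vector_derivative V) (at 0)"
    using assms unfolding tangent_space_def curve_with_velocity_def by auto
  have entry: "((\<lambda>x. \<gamma> x $ i $ j) has_vector_derivative V $ i $ j) (at 0)" for i j
    using bounded_linear.has_vector_derivative[OF bounded_linear_vec_nth
        bounded_linear.has_vector_derivative[OF bounded_linear_vec_nth deriv]] .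
  have "((\<lambda>x. \<Sum>j\<in>UNIV. \<gamma> x $ i $ j * cnj (\<gamma> x $ k $ j)) has_vector_derivative
      (\<Sum>j\<in>UNIV. \<gamma> 0 $ i $ j * cnj (V $ k $ j) + V $ i $ j * cnj (\<gamma> 0 $ k $ j))) (at 0)"
    by (intro has_vector_derivative_sum has_vector_derivative_mult entry
        bounded_linear.has_vector_derivative[OF bounded_linear_cnj])
  moreover have "((\<lambda>x. \<Sum>j\<in>UNIV. \<gamma> x $ i $ j * cnj (\<gamma> x $ k $ j)) has_vector_derivative 0) (at 0)"
  proof (rule has_vector_derivative_transform_within_open)
    show "((\<lambda>x. if i = k then 1 else 0) has_vector_derivative (0::complex)) (at (0::real))"
      by (rule has_vector_derivative_const)
    show "open {-e<..<e}" "0 \<in> {-e<..<e}" using e by auto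
    show "(if i = k then 1 else 0) = (\<Sum>j\<in>UNIV. \<gamma> x $ i $ j * cnj (\<gamma> x $ k $ j))"
      if "x \<in> {-e<..<e}" for x
      using unitary_rows[of "\<gamma> x" i k] \<gamma>(1) that by force
  qed
  ultimately have "(\<Sum>j\<in>UNIV. U $ i $ j * cnj (V $ k $ j) + V $ i $ j * cnj (U $ k $ j)) = 0"
    using vector_derivative_unique_at unfolding \<gamma>(2) by blast
  then show ?thesis by (simp add: sum.distrib eq_neg_iff_add_eq_0 mult.commute add.commute)
qed

text \<open>With \<open>A = V * U\<^sup>*\<close> anti-Hermitian, the sum is the trace of \<open>A\<close> against a Hermitian
  matrix which by hypothesis commutes with the projection onto the rows \<open>P\<close>.\<close>

lemma tangent_block_sum:
  fixes U :: "complex^'n^'n"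
  assumes U: "U \<in> unitary_group" and V: "V \<in> tangent_space unitary_group U"
    and block: "\<And>i k. i \<in> P \<Longrightarrow> k \<notin> P \<Longrightarrow> (\<Sum>j\<in>Q. cnj (U $ i $ j) * U $ k $ j) = 0"
  shows "(\<Sum>i\<in>P. \<Sum>j\<in>Q. U $ i $ j \<bullet> V $ i $ j) = 0"
proof -
  define A where "A i k = (\<Sum>j\<in>UNIV. V $ i $ j * cnj (U $ k $ j))" for i k
  define G where "G i k = (\<Sum>j\<in>Q. cnj (U $ i $ j) * U $ k $ j)" for i k
  have A: "cnj (A i k) = - A k i" for i k
    using tangent_unitary_group[OF V, of k i] by (simp add: A_def)
  have G: "cnj (G i k) = G k i" for i k by (simp add: G_def mult.commute)
  have V_eq: "V $ i $ j = (\<Sum>k\<in>UNIV. A i k * U $ k $ j)" for i j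
  proof -
    have "(\<Sum>k\<in>UNIV. A i k * U $ k $ j) = (\<Sum>k\<in>UNIV. \<Sum>l\<in>UNIV. V $ i $ l * (cnj (U $ k $ l) * U $ k $ j))"
      by (simp add: A_def sum_distrib_right mult.assoc)
    also have "\<dots> = (\<Sum>l\<in>UNIV. V $ i $ l * (\<Sum>k\<in>UNIV. cnj (U $ k $ l) * U $ k $ j))"
      by (subst sum.swap) (simp add: sum_distrib_left)
    also have "\<dots> = V $ i $ j" unfolding unitary_columns[OF U] by (simp add: if_distrib cong: if_cong)
    finally show ?thesis ..
  qed
  have "(\<Sum>j\<in>Q. cnj (U $ i $ j) * V $ i $ j) = (\<Sum>k\<in>P. A i k * G i k)" if "i \<in> P" for i
  proof -
    have "(\<Sum>j\<in>Q. cnj (U $ i $ j) * V $ i $ j) = (\<Sum>k\<in>UNIV. A i k * G i k)"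
      unfolding V_eq G_def sum_distrib_left by (subst sum.swap) (simp add: mult_ac)
    also have "\<dots> = (\<Sum>k\<in>P. A i k * G i k)"
      using block[OF that] by (intro sum.mono_neutral_right) (auto simp: G_def)
    finally show ?thesis .
  qed
  then have F: "(\<Sum>i\<in>P. \<Sum>j\<in>Q. cnj (U $ i $ j) * V $ i $ j) = (\<Sum>i\<in>P. \<Sum>k\<in>P. A i k * G i k)"
    by simp
  \<comment> \<open>\<open>A\<close> is anti-Hermitian and \<open>G\<close> Hermitian, so
    conjugation exchanges the indices with a sign: the sum is purely imaginary.\<close>
  have "cnj (\<Sum>i\<in>P. \<Sum>k\<in>P. A i k * G i k) = - (\<Sum>i\<in>P. \<Sum>k\<in>P. A k i * G k i)"
    by (simp add: A G sum_negf)
  also have "\<dots> = - (\<Sum>i\<in>P. \<Sum>k\<in>P. A i k * G i k)"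
    by (subst sum.swap) (rule refl)
  finally have "Re (\<Sum>i\<in>P. \<Sum>k\<in>P. A i k * G i k) = 0"
    by (simp add: complex_eq_iff)
  then show ?thesis unfolding F[symmetric] by (simp add: inner_complex_def)
qed

lemma sq_moduli_has_derivative:
  "(sq_moduli has_derivative (\<lambda>V. \<chi> i j. 2 * (U $ i $ j \<bullet> V $ i $ j))) (at U)"
proof -
  have entry: "((\<lambda>U. (cmod (U $ i $ j))\<^sup>2) has_derivative (\<lambda>V. 2 * (U $ i $ j \<bullet> V $ i $ j))) (at U)" for i j
    unfolding power2_norm_eq_inner
    by (auto intro!: derivative_eq_intros bounded_linear.has_derivative[OF bounded_linear_vec_nth] simp: inner_commute)
  show ?thesis
    unfolding sq_moduli_def
    by (subst has_derivative_componentwise_within)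
      (auto simp: Basis_vec_def inner_axis intro!: entry)
qed

text \<open>\<open>B_star\<close> lies on every such hyperplane and serves as base point.\<close>

lemma direction_hyperplane:
  assumes "X \<in> sums_zero" "X $ 0 $ 0 + X $ 0 $ c + X $ r $ 0 + X $ r $ c = 0"
  shows "X \<in> direction (hyperplane r c)"
proof -
  have "B_star \<in> hyperplane r c" "B_star + X \<in> hyperplane r c"
    using assms by (simp_all add: hyperplane_def sums_one_def sums_zero_def B_star_def sum.distrib)
  moreover have "X = (B_star + X) - B_star" by simp
  ultimately show ?thesis unfolding direction_def by blast
qed

lemma differential_at_hadamard:
  assumes U: "U \<in> unitary_group" and flat: "sq_moduli U = B_star"
  obtains r c where "r \<noteq> 0" "c \<noteq> 0"
    "differential unitary_group sq_moduli U ` tangent_space unitary_group U \<subseteq> direction (hyperplane r c)"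
proof -
  have "(cmod (U $ i $ j))\<^sup>2 = 1 / 4" for i j
    using flat by (simp add: sq_moduli_def B_star_def vec_eq_iff)
  from hadamard_block_orthogonal[OF U this] obtain r c where rc: "r \<noteq> 0" "c \<noteq> 0"
    and block: "\<And>i k. i \<in> {0, r} \<Longrightarrow> k \<notin> {0, r} \<Longrightarrow> (\<Sum>j\<in>{0, c}. cnj (U $ i $ j) * U $ k $ j) = 0"
    by blast
  have "differential unitary_group sq_moduli U V \<in> direction (hyperplane r c)"
    if V: "V \<in> tangent_space unitary_group U" for V
    unfolding differential_eq[OF sq_moduli_has_derivative V]
  proof (rule direction_hyperplane)
    \<comment> \<open>Row and column sums are block sums too: orthogonality of the rows covers
      \<open>P = {i}\<close>, and no row lies outside \<open>P = UNIV\<close>.\<close>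
    have "(\<Sum>j\<in>UNIV. U $ i $ j \<bullet> V $ i $ j) = 0" for i
      using tangent_block_sum[OF U V, of "{i}" UNIV] unitary_rows[OF U] by (force simp: mult.commute)
    moreover have "(\<Sum>i\<in>UNIV. U $ i $ j \<bullet> V $ i $ j) = 0" for j
      using tangent_block_sum[OF U V, of UNIV "{j}"] by simp
    ultimately show "(\<chi> i j. 2 * (U $ i $ j \<bullet> V $ i $ j)) \<in> sums_zero"
      by (simp add: sums_zero_def sum_distrib_left[symmetric])
    show "(\<chi> i j. 2 * (U $ i $ j \<bullet> V $ i $ j)) $ 0 $ 0 + (\<chi> i j. 2 * (U $ i $ j \<bullet> V $ i $ j)) $ 0 $ c
      + (\<chi> i j. 2 * (U $ i $ j \<bullet> V $ i $ j)) $ r $ 0 + (\<chi> i j. 2 * (U $ i $ j \<bullet> V $ i $ j)) $ r $ c = 0"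
      using tangent_block_sum[OF U V, of "{0, r}" "{0, c}"] block rc by simp
  qed
  then show thesis using that rc by blast
qed

theorem theorem4:
  shows "(\<forall>N. nbhd_in_sums_one N B_star \<longrightarrow> (\<exists>B\<in>N. bistochastic B \<and> \<not> unistochastic B))
    \<and> (\<forall>U\<^sub>0\<in>unitary_group. sq_moduli U\<^sub>0 = B_star \<longrightarrow>
          (\<exists>r\<in>{1, 2, 3}. \<exists>c\<in>{1, 2, 3}.
             differential unitary_group sq_moduli U\<^sub>0 ` tangent_space unitary_group U\<^sub>0
               \<subseteq> direction (hyperplane r c)))"
proof (intro conjI allI impI ballI)
  fix N assume "nbhd_in_sums_one N B_star"
  then show "\<exists>B\<in>N. bistochastic B \<and> \<not> unistochastic B"
    by (rule nbhd_contains_non_unistochastic)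
next
  fix U :: "complex^4^4" assume "U \<in> unitary_group" "sq_moduli U = B_star"
  then obtain r c where "r \<noteq> 0" "c \<noteq> 0"
    "differential unitary_group sq_moduli U ` tangent_space unitary_group U \<subseteq> direction (hyperplane r c)"
    by (rule differential_at_hadamard)
  moreover from this have "r \<in> {1, 2, 3}" "c \<in> {1, 2, 3}"
    unfolding nonzero_4[symmetric] by simp_all
  ultimately show "\<exists>r\<in>{1, 2, 3}. \<exists>c\<in>{1, 2, 3}.
      differential unitary_group sq_moduli U ` tangent_space unitary_group U \<subseteq> direction (hyperplane r c)"
    by (intro bexI)
qed

end
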